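(* Let $M$ and $r$ be integers such that $M\geq 1$ and $0\leq r<M$. Define the set of residues modulo $M$ $$\mathcal{Q}_{M}=\left\{48x^{2}+14x+1\ (\mathrm{mod}\ M):x\in\mathbb{Z}\right\}\cup\left\{48x^{2}+46x+11\ (\mathrm{mod}\ M):x\in\mathbb{Z}\right\}.$$ Then: (i) $DSOME(2Mn+2r)\equiv 0\pmod 4$ holds for all integers $n\geq 0$ if and only if $r\notin\mathcal{Q}_{M}$. (ii) If $\gcd(M,6)=1$, then $DSOME(2Mn+2r)\equiv 0\pmod 4$ holds for all integers $n\geq 0$ if and only if $48r+1$ is not congruent modulo $M$ to a perfect square. (iii) If $M=p\geq 5$ is a prime, then $DSOME(2pn+2r)\equiv 0\pmod 4$ holds for all integers $n\geq 0$ if and only if $$\left(\frac{48r+1}{p}\right)=-1,$$ where $\left(\frac{\cdot}{p}\right)$ denotes the Legendre symbol.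
   Context: $DSOME(n)$ denotes the sum of all the odd parts in all the partitions of $n$ into distinct parts minus the sum of all the even parts in all those same partitions, with $DSOME(0)=0$. Equivalently, $\sum_{n\ge 0}DSOME(n)q^n=\prod_{j\ge1}(1+q^j)\cdot\sum_{m\ge 1}\frac{(-1)^{m-1}q^m}{(1+q^m)^2}$. Membership $r\in\mathcal Q_M$ means that $r$ is congruent modulo $M$ to $48x^2+14x+1$ or to $48x^2+46x+11$ for some $x\in\mathbb Z$. The Legendre symbol $\left(\frac{a}{p}\right)$ is $0$ if $p\mid a$, $1$ if $a$ is a nonzero square modulo $p$, and $-1$ otherwise. *)

theory Defs
  imports "HOL-Number_Theory.Number_Theory"
begin

text \<open>A partition of \<open>n\<close> into distinct parts is determined by its set of parts, a finite set of
  positive integers with sum \<open>n\<close>; the only such set for \<open>n = 0\<close> is the empty one.\<close>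

definition distinct_partitions :: "nat \<Rightarrow> nat set set" where
  "distinct_partitions n = {P. finite P \<and> 0 \<notin> P \<and> \<Sum>P = n}"

text \<open>Finiteness is what makes the outer sums in \<open>DSOME\<close> genuine, since \<open>sum\<close> over an infinite set
  is \<open>0\<close> by convention.\<close>

lemma finite_distinct_partitions: "finite (distinct_partitions n)"
proof (rule finite_subset)
  show "distinct_partitions n \<subseteq> Pow {..n}"
    unfolding distinct_partitions_def by (auto intro: member_le_sum[where f = "\<lambda>x. x"])
qed simp

definition DSOME :: "nat \<Rightarrow> int" where
  "DSOME n =
     (\<Sum>P\<in>distinct_partitions n. \<Sum>k\<in>{k \<in> P. odd k}. int k) -
     (\<Sum>P\<in>distinct_partitions n. \<Sum>k\<in>{k \<in> P. even k}. int k)"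

text \<open>Residue classes modulo \<open>M \<ge> 1\<close> are represented by their least nonnegative elements.\<close>

definition Q_residues :: "nat \<Rightarrow> int set" where
  "Q_residues M =
     {(48 * x\<^sup>2 + 14 * x + 1) mod int M | x :: int. True} \<union>
     {(48 * x\<^sup>2 + 46 * x + 11) mod int M | x :: int. True}"

end

theory Submission
  imports Defs "HOL-Computational_Algebra.Polynomial"
begin

text \<open>
  All parts of all partitions of \<open>n\<close> into distinct parts add up to \<open>n\<close> times the number
  \<open>Q(n)\<close> of these partitions, so \<open>DSOME n\<close> is \<open>n Q(n)\<close> minus twice a sum of even
  numbers. Modulo 4 the latter vanishes, and for an even argument \<open>DSOME (2 n)\<close> is
  congruent to \<open>2 n Q(2 n)\<close>. Hence it is nonzero modulo 4 exactly when both \<open>n\<close> and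
  \<open>Q(2 n)\<close> are odd (\<open>DSOME_even_cong_0_iff\<close>).

  Euler's pentagonal number theorem gives the parity of \<open>Q(m)\<close>. Modulo 2 it does not matter
  whether a partition is counted with weight \<open>1\<close> or with weight \<open>(-1) ^ card P\<close>, and the
  signed count is \<open>1\<close> or \<open>-1\<close> if \<open>m = k (3 k + 1) / 2\<close> for some integer
  \<open>k\<close>, and \<open>0\<close> otherwise (\<open>euler_pentagonal\<close>). The theorem is read off from a
  polynomial identity of Shanks (\<open>shanks_identity\<close>), which is an exact evaluation of the
  product \<open>(1 - x) \<dots> (1 - x ^ m)\<close> up to terms of degree greater than \<open>m\<close> and so avoids
  infinite products.

  The condition becomes that \<open>n\<close> is odd and \<open>4 n = k (3 k + 1)\<close>. This forces \<open>k\<close> to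
  be 1 or 4 modulo 8, and these two classes yield the two quadratic polynomials that define
  \<open>Q_residues\<close> (\<open>odd_quarter_pentagonal_iff\<close>). Their values are positive, so a residue class
  modulo \<open>M\<close> contains one of them if and only if it does so at some \<open>M n + r\<close> with
  \<open>n \<ge> 0\<close>. Since 48 times a value, plus 1, is \<open>(48 x + 7)\<^sup>2\<close> or
  \<open>(48 x + 23)\<^sup>2\<close>, the set \<open>Q_residues M\<close> is described by
  the condition that \<open>48 r + 1\<close> be a square modulo \<open>M\<close>, as soon as 48 is invertible there.
\<close>

section \<open>A finite form of the pentagonal number theorem\<close>

definition triangular :: "nat \<Rightarrow> nat" where
  "triangular s = s * (s + 1) div 2"

lemma triangular_0 [simp]: "triangular 0 = 0"
  by (simp add: triangular_def)

lemma triangular_Suc: "triangular (Suc s) = triangular s + Suc s"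
  by (simp add: triangular_def)

text \<open>The generalized pentagonal numbers. With \<open>3 * k + 1\<close> in place of the more common
  \<open>3 * k - 1\<close>, the argument \<open>k\<close> is negated.\<close>

definition pentagonal :: "int \<Rightarrow> nat" where
  "pentagonal k = nat (k * (3 * k + 1) div 2)"

lemma two_pentagonal: "2 * int (pentagonal k) = k * (3 * k + 1)"
proof -
  have "0 \<le> k * (3 * k + 1)"
  proof (cases "0 \<le> k")
    case False
    then show ?thesis by (intro mult_nonpos_nonpos) auto
  qed simp
  moreover have "even (k * (3 * k + 1))" by simp
  ultimately show ?thesis by (simp add: pentagonal_def)
qed

lemma two_triangular: "2 * triangular s = s * (s + 1)"
  by (simp add: triangular_def)

lemma pentagonal_pos_eq: "pentagonal (int s) = s * s + triangular s"
proof -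
  have "2 * int (pentagonal (int s)) = 2 * int (s * s) + int (2 * triangular s)"
    unfolding two_pentagonal two_triangular by (simp add: algebra_simps)
  then show ?thesis by linarith
qed

lemma pentagonal_neg_eq: "pentagonal (- int (Suc s)) = Suc s * Suc s + triangular s"
proof -
  have "2 * int (pentagonal (- int (Suc s))) = 2 * int (Suc s * Suc s) + int (2 * triangular s)"
    unfolding two_pentagonal two_triangular by (simp add: algebra_simps)
  then show ?thesis by linarith
qed

lemma pentagonal_inject: "pentagonal j = pentagonal k \<longleftrightarrow> j = k"
proof
  assume "pentagonal j = pentagonal k"
  then have "j * (3 * j + 1) = k * (3 * k + 1)"
    by (metis two_pentagonal)
  then have "(j - k) * (3 * (j + k) + 1) = 0" by (simp add: algebra_simps)
  moreover have "3 * (j + k) + 1 \<noteq> 0" by presburger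
  ultimately show "j = k" by simp
qed simp

lemma abs_le_pentagonal: "\<bar>k\<bar> \<le> int (pentagonal k)"
proof -
  have "\<bar>k\<bar> \<le> k * k"
    using mult_mono[of 1 "\<bar>k\<bar>" "\<bar>k\<bar>" "\<bar>k\<bar>"] by (cases "k = 0") (auto simp: abs_mult_self_eq)
  then have "2 * \<bar>k\<bar> \<le> 3 * (k * k) + k" by linarith
  also have "\<dots> = 2 * int (pentagonal k)"
    unfolding two_pentagonal by (simp add: algebra_simps)
  finally show ?thesis by simp
qed

text \<open>With \<open>P n = (1 - x) \<dots> (1 - x ^ n)\<close>, this is the quotient \<open>P n / P s\<close>; as a product it
  makes sense in every commutative ring.\<close>

definition gap_product :: "'a::comm_ring_1 \<Rightarrow> nat \<Rightarrow> nat \<Rightarrow> 'a" where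
  "gap_product x s n = (\<Prod>i\<in>{s<..n}. 1 - x ^ i)"

lemma gap_product_refl [simp]: "gap_product x n n = 1"
  by (simp add: gap_product_def)

lemma gap_product_Suc_right:
  "s \<le> n \<Longrightarrow> gap_product x s (Suc n) = gap_product x s n * (1 - x ^ Suc n)"
  by (simp add: gap_product_def atLeastSucAtMost_greaterThanAtMost [symmetric] mult.commute)

lemma gap_product_Suc_left:
  "s < n \<Longrightarrow> gap_product x s n = (1 - x ^ Suc s) * gap_product x (Suc s) n"
proof -
  assume "s < n"
  then have "{s<..n} = insert (Suc s) {Suc s<..n}" by auto
  then show ?thesis by (simp add: gap_product_def)
qed

definition shanks_term :: "'a::comm_ring_1 \<Rightarrow> nat \<Rightarrow> nat \<Rightarrow> 'a" where
  "shanks_term x n s = (-1) ^ s * gap_product x s n * x ^ (s * n + triangular s)"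

text \<open>Raising \<open>n\<close> by one multiplies the term for \<open>s\<close> by \<open>x ^ s * (1 - x ^ Suc n)\<close>. The change thus
  splits into a part with the factor \<open>1 - x ^ s\<close> and one with the factor \<open>x ^ Suc n\<close>. As
  \<open>1 - x ^ s\<close> turns \<open>P n / P s\<close> into \<open>P n / P (s - 1)\<close>, the first part for \<open>s\<close> cancels the
  second part for \<open>s - 1\<close>, and only the second part for the last index \<open>m\<close> survives.\<close>

lemma shanks_term_telescope:
  fixes x :: "'a::comm_ring_1"
  assumes "m \<le> n"
  shows "(\<Sum>s\<le>m. shanks_term x (Suc n) s - shanks_term x n s) =
    - ((-1) ^ m * gap_product x m n * x ^ (Suc m * Suc n + triangular m))"
  using assms
proof (induction m)
  case 0
  then show ?case
    by (simp add: shanks_term_def gap_product_Suc_right algebra_simps)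
next
  case (Suc m)
  \<comment> \<open>\<open>E\<close> is the exponent both in the surviving term for \<open>m\<close> and in the old term for \<open>Suc m\<close>.\<close>
  define E where "E = Suc m * Suc n + triangular m"
  define Q where "Q = gap_product x (Suc m) n"
  have E1: "Suc m * n + triangular (Suc m) = E"
    and E2: "Suc m * Suc n + triangular (Suc m) = E + Suc m"
    and E3: "Suc (Suc m) * Suc n + triangular (Suc m) = E + Suc m + Suc n"
    by (simp_all add: E_def triangular_Suc)
  have "gap_product x m n = (1 - x ^ Suc m) * Q"
    using Suc.prems by (simp add: Q_def gap_product_Suc_left)
  moreover have "gap_product x (Suc m) (Suc n) = Q * (1 - x ^ Suc n)"
    using Suc.prems by (simp add: Q_def gap_product_Suc_right)
  ultimately have "(\<Sum>s\<le>Suc m. shanks_term x (Suc n) s - shanks_term x n s) =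
      - ((-1) ^ m * ((1 - x ^ Suc m) * Q) * x ^ E) +
      ((-1) ^ Suc m * (Q * (1 - x ^ Suc n)) * x ^ (E + Suc m) - (-1) ^ Suc m * Q * x ^ E)"
    using Suc.IH Suc.prems
    by (simp only: sum.atMost_Suc shanks_term_def E1 E2 E_def [symmetric] Q_def [symmetric] Suc_leD)
  also have "\<dots> = - ((-1) ^ Suc m * Q * x ^ (E + Suc m + Suc n))"
    by (simp add: power_add algebra_simps)
  finally show ?case
    by (simp only: E3 Q_def)
qed

text \<open>In the step to \<open>Suc n\<close> the left-hand side changes in two ways: it gains the term for
  \<open>s = Suc n\<close>, which is the new summand at \<open>k = Suc n\<close>, and its old terms change by the
  telescoped remainder, which is the new summand at \<open>k = - Suc n\<close>.\<close>

theorem shanks_identity: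
  fixes x :: "'a::comm_ring_1"
  shows "(\<Sum>s\<le>n. shanks_term x n s) =
    (\<Sum>k\<in>{- int n..int n}. (-1) ^ nat \<bar>k\<bar> * x ^ pentagonal k)"
proof (induction n)
  case 0
  then show ?case by (simp add: shanks_term_def pentagonal_def)
next
  case (Suc n)
  let ?f = "\<lambda>k. (-1) ^ nat \<bar>k\<bar> * x ^ pentagonal k"
  have "{- int (Suc n)..int (Suc n)} =
      insert (int (Suc n)) (insert (- int (Suc n)) {- int n..int n})"
    by auto
  then have "(\<Sum>k\<in>{- int (Suc n)..int (Suc n)}. ?f k) =
      ?f (int (Suc n)) + (?f (- int (Suc n)) + (\<Sum>k\<in>{- int n..int n}. ?f k))"
    by (simp del: of_nat_Suc)
  also have "(\<Sum>k\<in>{- int n..int n}. ?f k) = (\<Sum>s\<le>n. shanks_term x n s)"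
    by (rule Suc.IH [symmetric])
  also have "?f (int (Suc n)) = shanks_term x (Suc n) (Suc n)"
    unfolding pentagonal_pos_eq by (simp add: shanks_term_def del: of_nat_Suc)
  also have "?f (- int (Suc n)) = (\<Sum>s\<le>n. shanks_term x (Suc n) s - shanks_term x n s)"
    unfolding shanks_term_telescope [OF order_refl] pentagonal_neg_eq
    by (simp add: nat_add_distrib del: of_nat_Suc)
  finally show ?case
    by (simp add: sum_subtractf)
qed

section \<open>The parity of the number of partitions into distinct parts\<close>

text \<open>Expanding the product amounts to choosing the set \<open>P\<close> of those \<open>i\<close> whose factor
  contributes \<open>- x ^ i\<close>.\<close>

lemma coeff_gap_product:
  "coeff (gap_product (monom (1::int) 1) 0 n) n =
    (\<Sum>P\<in>distinct_partitions n. (-1) ^ card P)"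
proof -
  have "gap_product (monom (1::int) 1) 0 n = (\<Prod>i\<in>{0<..n}. - monom 1 i + 1)"
    by (simp add: gap_product_def monom_power)
  also have "\<dots> = (\<Sum>P\<in>Pow {0<..n}. \<Prod>i\<in>P. - monom 1 i)"
    by (subst prod_add) auto
  also have "\<dots> = (\<Sum>P\<in>Pow {0<..n}. monom ((-1) ^ card P) (\<Sum>P))"
  proof (rule sum.cong [OF refl])
    fix P assume "P \<in> Pow {0<..n}"
    then have "finite P" using finite_subset by blast
    then show "(\<Prod>i\<in>P. - monom 1 i) = monom ((-1::int) ^ card P) (\<Sum>P)"
      by (induction P rule: finite_induct) (simp_all add: mult_monom minus_monom)
  qed
  finally have "coeff (gap_product (monom (1::int) 1) 0 n) n =
      (\<Sum>P\<in>Pow {0<..n}. if \<Sum>P = n then (-1) ^ card P else 0)"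
    by (simp add: coeff_sum)
  also have "\<dots> = (\<Sum>P\<in>{P \<in> Pow {0<..n}. \<Sum>P = n}. (-1) ^ card P)"
    by (rule sum.inter_filter [symmetric]) simp
  also have "{P \<in> Pow {0<..n}. \<Sum>P = n} = distinct_partitions n"
    unfolding distinct_partitions_def
    by (auto intro: finite_subset member_le_sum[where f = "\<lambda>x. x"] gr0I)
  finally show ?thesis .
qed

text \<open>Compare the coefficients of \<open>x ^ n\<close> in Shanks' identity. The term for \<open>s = 0\<close> is the
  product \<open>P n\<close>, and every other term is divisible by \<open>x ^ Suc n\<close>.\<close>

theorem euler_pentagonal:
  "(\<Sum>P\<in>distinct_partitions n. (-1) ^ card P) =
    (\<Sum>k | pentagonal k = n. (-1::int) ^ nat \<bar>k\<bar>)"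
proof -
  let ?x = "monom (1::int) 1"
  have "coeff (shanks_term ?x n s) n = 0" if "s \<in> {..n} - {0}" for s
  proof -
    have "n \<le> s * n" "0 < triangular s"
      using that two_triangular[of s] by auto
    then have "n < s * n + triangular s" by linarith
    moreover have "shanks_term ?x n s =
        monom 1 (s * n + triangular s) * ((-1) ^ s * gap_product ?x s n)"
      by (simp add: shanks_term_def monom_power mult.commute)
    ultimately show ?thesis by (simp add: coeff_monom_mult)
  qed
  then have "coeff (\<Sum>s\<le>n. shanks_term ?x n s) n = coeff (shanks_term ?x n 0) n"
    by (simp add: coeff_sum sum.remove[of "{..n}" 0])
  also have "\<dots> = (\<Sum>P\<in>distinct_partitions n. (-1) ^ card P)"
    using coeff_gap_product[of n] by (simp add: shanks_term_def)
  finally have "(\<Sum>P\<in>distinct_partitions n. (-1) ^ card P) =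
      (\<Sum>k\<in>{- int n..int n}. coeff ((-1) ^ nat \<bar>k\<bar> * ?x ^ pentagonal k) n)"
    by (simp add: shanks_identity coeff_sum)
  also have "\<dots> = (\<Sum>k\<in>{- int n..int n}. if pentagonal k = n then (-1) ^ nat \<bar>k\<bar> else 0)"
  proof (rule sum.cong [OF refl])
    fix k
    have "(-1) ^ nat \<bar>k\<bar> * ?x ^ pentagonal k = monom ((-1) ^ nat \<bar>k\<bar>) (pentagonal k)"
      by (cases "even (nat \<bar>k\<bar>)") (simp_all add: monom_power minus_monom)
    then show "coeff ((-1) ^ nat \<bar>k\<bar> * ?x ^ pentagonal k) n =
        (if pentagonal k = n then (-1) ^ nat \<bar>k\<bar> else 0)"
      by simp
  qed
  also have "\<dots> = (\<Sum>k\<in>{k \<in> {- int n..int n}. pentagonal k = n}. (-1) ^ nat \<bar>k\<bar>)"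
    by (rule sum.inter_filter [symmetric]) simp
  also have "{k \<in> {- int n..int n}. pentagonal k = n} = {k. pentagonal k = n}"
  proof -
    have "- int (pentagonal k) \<le> k" "k \<le> int (pentagonal k)" for k
      using abs_le_pentagonal[of k] by linarith+
    then show ?thesis by auto
  qed
  finally show ?thesis .
qed

corollary odd_card_distinct_partitions_iff:
  "odd (card (distinct_partitions n)) \<longleftrightarrow> (\<exists>k. pentagonal k = n)"
proof -
  have "odd (card (distinct_partitions n)) \<longleftrightarrow>
      odd (\<Sum>P\<in>distinct_partitions n. (-1::int) ^ card P)"
    using finite_distinct_partitions[of n] by (simp add: even_sum_iff)
  also have "\<dots> \<longleftrightarrow> (\<exists>k. pentagonal k = n)"
  proof (cases "\<exists>k. pentagonal k = n")
    case True
    then obtain k where k: "pentagonal k = n" by blast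
    then have "{k. pentagonal k = n} = {k}" by (auto simp: pentagonal_inject)
    then show ?thesis using k by (simp add: euler_pentagonal) blast
  next
    case False
    then have "{k. pentagonal k = n} = {}" by blast
    then show ?thesis using False by (simp add: euler_pentagonal)
  qed
  finally show ?thesis .
qed

section \<open>The sums of odd and even parts modulo 4\<close>

text \<open>Odd and even parts together contribute \<open>n\<close> for each partition; the even ones are then
  subtracted twice.\<close>

lemma DSOME_conv_card:
  "DSOME n = int n * int (card (distinct_partitions n)) -
    2 * (\<Sum>P\<in>distinct_partitions n. \<Sum>k\<in>{k \<in> P. even k}. int k)"
proof -
  have "(\<Sum>k\<in>{k \<in> P. odd k}. int k) = int n - (\<Sum>k\<in>{k \<in> P. even k}. int k)"
    if "P \<in> distinct_partitions n" for P
  proof -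
    have "finite P" "int n = (\<Sum>k\<in>P. int k)"
      using that by (auto simp: distinct_partitions_def)
    moreover have "P = {k \<in> P. odd k} \<union> {k \<in> P. even k}" by auto
    ultimately have "int n = (\<Sum>k\<in>{k \<in> P. odd k}. int k) + (\<Sum>k\<in>{k \<in> P. even k}. int k)"
      by (smt (verit, best) disjoint_iff finite_Un mem_Collect_eq sum.union_disjoint)
    then show ?thesis by simp
  qed
  then show ?thesis by (simp add: DSOME_def sum_subtractf)
qed

lemma DSOME_even_cong_0_iff:
  "[DSOME (2 * n) = 0] (mod 4) \<longleftrightarrow> even n \<or> even (card (distinct_partitions (2 * n)))"
proof -
  have "even (\<Sum>P\<in>distinct_partitions (2 * n). \<Sum>k\<in>{k \<in> P. even k}. int k)"
    by (intro dvd_sum) auto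
  then obtain e where "(\<Sum>P\<in>distinct_partitions (2 * n). \<Sum>k\<in>{k \<in> P. even k}. int k) = 2 * e"
    by (elim evenE)
  then have "DSOME (2 * n) = 2 * int (n * card (distinct_partitions (2 * n))) - 4 * e"
    by (simp add: DSOME_conv_card)
  then have "[DSOME (2 * n) = 0] (mod 4) \<longleftrightarrow> even (int (n * card (distinct_partitions (2 * n))))"
    unfolding cong_0_iff by presburger
  then show ?thesis by simp
qed

definition Q_family :: "int set" where
  "Q_family = range (\<lambda>x. 48 * x\<^sup>2 + 14 * x + 1) \<union> range (\<lambda>x. 48 * x\<^sup>2 + 46 * x + 11)"

text \<open>For odd \<open>n\<close>, \<open>k * (3 * k + 1)\<close> must be 4 modulo 8, which leaves the classes of 1 and 4
  modulo 8 for \<open>k\<close>. Substituting \<open>k = 8 * x + 1\<close> gives the first polynomial, substituting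
  \<open>k = - 8 * x - 4\<close> the second.\<close>

lemma odd_quarter_pentagonal_iff:
  "odd n \<and> (\<exists>k. k * (3 * k + 1) = 4 * n) \<longleftrightarrow> n \<in> Q_family" for n :: int
proof
  assume "odd n \<and> (\<exists>k. k * (3 * k + 1) = 4 * n)"
  then obtain k where "odd n" and k: "k * (3 * k + 1) = 4 * n" by blast
  define j where "j = k div 8"
  define c where "c = k mod 8"
  have kjc: "k = 8 * j + c" by (simp add: j_def c_def)
  have "c \<in> {0..<8}" by (simp add: c_def)
  then have "c \<in> {0,1,2,3,4,5,6,7}" by auto
  moreover have "c * (3 * c + 1) + 8 * (j * (24 * j + 6 * c + 1)) = 4 * n"
    using k by (simp add: kjc algebra_simps)
  ultimately have "c = 1 \<or> c = 4"
    using \<open>odd n\<close> by safe (simp_all, presburger+)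
  then show "n \<in> Q_family"
  proof
    assume "c = 1"
    then have "n = 48 * j\<^sup>2 + 14 * j + 1"
      using k by (simp add: kjc algebra_simps power2_eq_square)
    then show ?thesis by (auto simp: Q_family_def)
  next
    assume "c = 4"
    then have "n = 48 * (- j - 1)\<^sup>2 + 46 * (- j - 1) + 11"
      using k by (simp add: kjc algebra_simps power2_eq_square)
    then show ?thesis unfolding Q_family_def by blast
  qed
next
  assume "n \<in> Q_family"
  then consider x where "n = 48 * x\<^sup>2 + 14 * x + 1" | x where "n = 48 * x\<^sup>2 + 46 * x + 11"
    by (auto simp: Q_family_def)
  then show "odd n \<and> (\<exists>k. k * (3 * k + 1) = 4 * n)"
  proof cases
    case 1
    then have "(8 * x + 1) * (3 * (8 * x + 1) + 1) = 4 * n"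
      by (simp add: algebra_simps power2_eq_square)
    moreover have "odd n" using 1 by simp
    ultimately show ?thesis by blast
  next
    case 2
    then have "(- 8 * x - 4) * (3 * (- 8 * x - 4) + 1) = 4 * n"
      by (simp add: algebra_simps power2_eq_square)
    moreover have "odd n" using 2 by simp
    ultimately show ?thesis by blast
  qed
qed

theorem DSOME_even_cong_0_iff_Q_family:
  "[DSOME (2 * n) = 0] (mod 4) \<longleftrightarrow> int n \<notin> Q_family"
proof -
  have "pentagonal k = 2 * n \<longleftrightarrow> k * (3 * k + 1) = 4 * int n" for k
    using two_pentagonal[of k] by linarith
  then show ?thesis
    using odd_card_distinct_partitions_iff[of "2 * n"]
    by (auto simp: DSOME_even_cong_0_iff odd_quarter_pentagonal_iff [symmetric])
qed

section \<open>Arithmetic progressions\<close>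

lemma Q_family_pos: "n \<in> Q_family \<Longrightarrow> 0 < n"
proof -
  have "0 < 48 * x\<^sup>2 + 14 * x + 1" "0 < 48 * x\<^sup>2 + 46 * x + 11" for x :: int
  proof -
    have "\<bar>x\<bar> \<le> x\<^sup>2"
      using mult_mono[of 1 "\<bar>x\<bar>" "\<bar>x\<bar>" "\<bar>x\<bar>"]
      by (cases "x = 0") (auto simp: power2_eq_square)
    then show "0 < 48 * x\<^sup>2 + 14 * x + 1" "0 < 48 * x\<^sup>2 + 46 * x + 11" by linarith+
  qed
  then show "n \<in> Q_family \<Longrightarrow> 0 < n" by (auto simp: Q_family_def)
qed

lemma mem_Q_residues_iff:
  assumes "r < M"
  shows "int r \<in> Q_residues M \<longleftrightarrow> (\<exists>m\<in>Q_family. [m = int r] (mod int M))"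
  using assms by (auto simp: Q_residues_def Q_family_def cong_def eq_commute[of "int r"])

text \<open>A member of \<open>Q_family\<close> that is congruent to \<open>r\<close> has a nonnegative quotient by \<open>M\<close>, because
  it is positive; this quotient is the required index in the progression.\<close>

lemma DSOME_progression_iff:
  assumes "r < M"
  shows "(\<forall>n::nat. [DSOME (2 * M * n + 2 * r) = 0] (mod 4)) \<longleftrightarrow> int r \<notin> Q_residues M"
proof -
  have "(\<exists>n. int (M * n + r) \<in> Q_family) \<longleftrightarrow> (\<exists>m\<in>Q_family. [m = int r] (mod int M))"
  proof
    assume "\<exists>n. int (M * n + r) \<in> Q_family"
    then obtain n where "int (M * n + r) \<in> Q_family" ..
    then show "\<exists>m\<in>Q_family. [m = int r] (mod int M)"
      by (rule bexI [rotated]) (simp add: cong_def)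
  next
    assume "\<exists>m\<in>Q_family. [m = int r] (mod int M)"
    then obtain m where m: "m \<in> Q_family" "m mod int M = int r"
      using assms by (auto simp: cong_def)
    have "0 \<le> m div int M"
      using Q_family_pos[OF m(1)] assms by (simp add: pos_imp_zdiv_nonneg_iff)
    then have "m = int (M * nat (m div int M) + r)"
      using mult_div_mod_eq[of "int M" m] m(2) by simp
    then show "\<exists>n. int (M * n + r) \<in> Q_family" using m(1) by metis
  qed
  moreover have "2 * M * n + 2 * r = 2 * (M * n + r)" for n by simp
  ultimately show ?thesis
    using assms by (simp only: DSOME_even_cong_0_iff_Q_family mem_Q_residues_iff) blast
qed

text \<open>Completing the square maps both polynomials to squares. Conversely, if 48 is invertible
  modulo \<open>M\<close>, every \<open>y\<close> has the form \<open>48 * x + 7\<close> modulo \<open>M\<close>, so the first polynomial alone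
  reaches every \<open>r\<close> for which \<open>48 * r + 1\<close> is a square.\<close>

lemma Q_residues_iff_square:
  assumes "r < M" and "gcd M 6 = 1"
  shows "int r \<in> Q_residues M \<longleftrightarrow> (\<exists>y::int. [48 * int r + 1 = y\<^sup>2] (mod int M))"
proof
  assume "int r \<in> Q_residues M"
  then obtain m where "m \<in> Q_family" and m: "[m = int r] (mod int M)"
    using assms(1) by (auto simp: mem_Q_residues_iff)
  then consider x where "m = 48 * x\<^sup>2 + 14 * x + 1" | x where "m = 48 * x\<^sup>2 + 46 * x + 11"
    by (auto simp: Q_family_def)
  then have "\<exists>y. 48 * m + 1 = y\<^sup>2"
  proof cases
    case 1
    then have "48 * m + 1 = (48 * x + 7)\<^sup>2" by (simp add: power2_eq_square algebra_simps)
    then show ?thesis ..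
  next
    case 2
    then have "48 * m + 1 = (48 * x + 23)\<^sup>2" by (simp add: power2_eq_square algebra_simps)
    then show ?thesis ..
  qed
  then obtain y where "48 * m + 1 = y\<^sup>2" ..
  moreover have "[48 * int r + 1 = 48 * m + 1] (mod int M)"
    using m by (intro cong_add cong_mult cong_refl) (rule cong_sym)
  ultimately show "\<exists>y. [48 * int r + 1 = y\<^sup>2] (mod int M)" by metis
next
  assume "\<exists>y::int. [48 * int r + 1 = y\<^sup>2] (mod int M)"
  then obtain y where y: "[48 * int r + 1 = y\<^sup>2] (mod int M)" ..
  have "coprime (int M) 6"
    using assms(2) by (metis coprime_iff_gcd_eq_1 coprime_int_iff of_nat_numeral)
  then have "coprime 6 (int M)" by (simp add: coprime_commute)
  then have "coprime (6 ^ 4) (int M)" by (simp only: coprime_power_left_iff simp_thms)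
  moreover have "(48::int) dvd 6 ^ 4" by simp
  ultimately have cop: "coprime 48 (int M)"
    using coprime_divisors dvd_refl by blast
  then obtain u where u: "[48 * u = 1] (mod int M)"
    using cong_solve_coprime_int by blast
  define x where "x = u * (y - 7)"
  have "[48 * u * (y - 7) + 7 = 1 * (y - 7) + 7] (mod int M)"
    using u by (intro cong_add cong_mult cong_refl)
  then have "[48 * x + 7 = y] (mod int M)" by (simp add: x_def mult.assoc)
  then have "[(48 * x + 7)\<^sup>2 = y\<^sup>2] (mod int M)" by (rule cong_pow)
  then have "[(48 * x + 7)\<^sup>2 = 48 * int r + 1] (mod int M)"
    using y cong_sym cong_trans by blast
  moreover have "(48 * x + 7)\<^sup>2 = 48 * (48 * x\<^sup>2 + 14 * x + 1) + 1"
    by (simp add: power2_eq_square algebra_simps)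
  ultimately have "[48 * (48 * x\<^sup>2 + 14 * x + 1) = 48 * int r] (mod int M)"
    by (simp only: cong_add_rcancel)
  then have "[48 * x\<^sup>2 + 14 * x + 1 = int r] (mod int M)"
    using cop by (simp only: cong_mult_lcancel)
  then show "int r \<in> Q_residues M"
    unfolding mem_Q_residues_iff [OF assms(1)] Q_family_def by blast
qed

lemma Legendre_eq_minus_1_iff:
  "Legendre a p = -1 \<longleftrightarrow> \<not> (\<exists>y. [a = y\<^sup>2] (mod p))"
proof -
  have "QuadRes p a" if "[a = 0] (mod p)"
    unfolding QuadRes_def using that by (intro exI[of _ 0]) (simp add: cong_sym)
  then show ?thesis
    by (auto simp: Legendre_def QuadRes_def cong_sym_eq)
qed

theorem corollary4p6:
  fixes M r :: nat
  assumes "M \<ge> 1" and "r < M"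
  shows "((\<forall>n::nat. [DSOME (2 * M * n + 2 * r) = 0] (mod 4)) \<longleftrightarrow> int r \<notin> Q_residues M) \<and>
    (gcd M 6 = 1 \<longrightarrow>
      ((\<forall>n::nat. [DSOME (2 * M * n + 2 * r) = 0] (mod 4)) \<longleftrightarrow>
        \<not> (\<exists>y::int. [48 * int r + 1 = y\<^sup>2] (mod int M)))) \<and>
    (prime M \<and> M \<ge> 5 \<longrightarrow>
      ((\<forall>n::nat. [DSOME (2 * M * n + 2 * r) = 0] (mod 4)) \<longleftrightarrow>
        Legendre (48 * int r + 1) (int M) = -1))"
proof -
  have "gcd M 6 = 1" if "prime M" "M \<ge> 5"
  proof -
    have "\<not> M dvd 2 * 3"
      unfolding prime_dvd_mult_iff [OF that(1)] using that(2) by (auto dest: dvd_imp_le)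
    then show ?thesis
      using prime_imp_coprime[OF that(1), of 6] by simp
  qed
  then show ?thesis
    unfolding DSOME_progression_iff [OF assms(2)] Legendre_eq_minus_1_iff
    using Q_residues_iff_square [OF assms(2)] by metis
qed

end
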